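(* Let $\phi(t)=\sum_{k=1}^n c_k\cos(m_kt)$ and $\psi(t)=\sum_{k=1}^n d_k\sin(m_kt)$, where $c_k,d_k\in\mathbb{R}$ and the $m_k$ are coprime integers, and consider the plane curve $x=\phi(t)$, $y=\psi(t)$, $t\in\mathbb{R}$. Let $S_1,V_1$ be polynomials such that $$\psi(t)=\sin(t)\,\big[S_1(\sin^2 t)+\cos(t)\,V_1(\sin^2 t)\big]\qquad (t\in\mathbb{R}).$$ Suppose that $u_0\in\mathbb{R}$ satisfies $$S_1(1-u_0^2)+u_0V_1(1-u_0^2)=0,\qquad 0<u_0<1,$$ and that $t_1,t_2\in\mathbb{R}$ are such that $$u_0=\cos(t_1)=\cos(t_2),\qquad \sin(t_1)=-\sin(t_2)=\sqrt{1-u_0^2}>0 .$$ Set $x_0:=\phi(t_1)$. Then the point $(x_0,0)$ is a self-intersection point of the curve if and only if $\dot\phi(t_1)\neq0$ and $\dot\psi(t_1)\neq 0$.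
   Context: Dots denote $d/dt$. The curve has a self-intersection at a point $(x_0,y_0)$ if it has different tangent lines at this point, i.e. if the slope $y'(x_0)=\dot\psi(t)/\dot\phi(t)$ takes different values (the value $\infty$ being allowed when $\dot\phi(t)=0\ne\dot\psi(t)$) for different parameter values $t$ with $(\phi(t),\psi(t))=(x_0,y_0)$. Polynomials $S_1,V_1$ as in the claim always exist.
   Formalization: "Only if" fails when another branch passes through (x_0,0). The equivalence is proved for the branches at t_1, t_2; for the whole curve, "if" always holds, and "only if" is proved when every t with (φ(t),ψ(t)) = (x_0,0) has cos t = u_0. *)

theory Defs
  imports "HOL-Analysis.Analysis" "HOL-Computational_Algebra.Polynomial"
begin

text \<open>Here \<open>s\<close> is the slope of the tangent of \<open>t \<mapsto> (\<phi> t, \<psi> t)\<close> at the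
  parameter value \<open>t\<close>. The vertical tangent is always recorded as \<open>\<infinity>\<close>, never as \<open>-\<infinity>\<close>. If
  both derivatives vanish at \<open>t\<close>, there is no such \<open>s\<close>.\<close>

definition has_slope :: "(real \<Rightarrow> real) \<Rightarrow> (real \<Rightarrow> real) \<Rightarrow> real \<Rightarrow> ereal \<Rightarrow> bool" where
  "has_slope \<phi> \<psi> t s \<longleftrightarrow>
     deriv \<phi> t \<noteq> 0 \<and> s = ereal (deriv \<psi> t / deriv \<phi> t) \<or>
     deriv \<phi> t = 0 \<and> deriv \<psi> t \<noteq> 0 \<and> s = \<infinity>"

text \<open>The curve restricted to the parameter values in \<open>T\<close> passes through the point \<open>p\<close> with
  two different slopes. The whole curve corresponds to \<open>T = UNIV\<close>.\<close>

definition self_intersection_on ::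
    "real set \<Rightarrow> (real \<Rightarrow> real) \<Rightarrow> (real \<Rightarrow> real) \<Rightarrow> real \<times> real \<Rightarrow> bool" where
  "self_intersection_on T \<phi> \<psi> p \<longleftrightarrow>
     (\<exists>t\<in>T. \<exists>t'\<in>T. \<exists>s s'. (\<phi> t, \<psi> t) = p \<and> (\<phi> t', \<psi> t') = p \<and>
        has_slope \<phi> \<psi> t s \<and> has_slope \<phi> \<psi> t' s' \<and> s \<noteq> s')"

abbreviation self_intersection ::
    "(real \<Rightarrow> real) \<Rightarrow> (real \<Rightarrow> real) \<Rightarrow> real \<times> real \<Rightarrow> bool" where
  "self_intersection \<equiv> self_intersection_on UNIV"

end

theory Submission
  imports Defs
begin

text \<open>The curve is symmetric about the \<open>x\<close>-axis: reflecting the parameter fixes \<open>\<phi>\<close> and negates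
  \<open>\<psi>\<close>. Since the \<open>m k\<close> are integers, \<open>2 * pi\<close> is a period of both. Modulo this period, a parameter
  value with the cosine \<open>u0\<close> is \<open>t1\<close> or \<open>- t1\<close>, and \<open>t2\<close> is of the second kind. The equation for
  \<open>u0\<close> says that \<open>\<psi> t1 = 0\<close>, so all these parameter values are mapped to \<open>(x0, 0)\<close>.

  At those of the first kind the velocity is \<open>(A, B)\<close>, where \<open>A = deriv \<phi> t1\<close> and
  \<open>B = deriv \<psi> t1\<close>; at those of the second kind it is \<open>(- A, B)\<close>, because differentiation exchanges
  parity (\<open>cosine_sine_sums_at_congruent_parameter\<close>). If \<open>A\<close> and \<open>B\<close> are nonzero, the two slopes
  \<open>B / A\<close> and \<open>- (B / A)\<close> differ. Otherwise the tangents are all horizontal, all vertical or all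
  undefined, so parameter values with the cosine \<open>u0\<close> cannot yield two different slopes.\<close>

lemma cos_eq_imp_sin_eq_sign:
  fixes s t :: real
  assumes "cos s = cos t"
  obtains e :: real where "e = 1 \<or> e = -1" "sin s = e * sin t"
proof -
  have "(sin s)\<^sup>2 = (sin t)\<^sup>2"
    using assms by (simp add: sin_squared_eq)
  then have "sin s = sin t \<or> sin s = - sin t"
    by (simp add: power2_eq_iff)
  then show ?thesis
    using that[of 1] that[of "-1"] by auto
qed

lemma congruent_up_to_sign:
  fixes s t e :: real
  assumes e: "e = 1 \<or> e = -1" and "cos s = cos t" "sin s = e * sin t"
  obtains j :: int where "s = e * t + 2 * pi * of_int j"
proof -
  have "sin s = sin (e * t) \<and> cos s = cos (e * t)"
    using assms by auto
  then show ?thesis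
    using that unfolding sin_cos_eq_iff by (metis mult.assoc mult.commute)
qed

lemma sin_cos_integer_multiple_congruent:
  fixes t e :: real and m j :: int
  assumes "e = 1 \<or> e = -1"
  shows "cos (of_int m * (e * t + 2 * pi * of_int j)) = cos (of_int m * t)"
    and "sin (of_int m * (e * t + 2 * pi * of_int j)) = e * sin (of_int m * t)"
proof -
  have "of_int m * (e * t + 2 * pi * of_int j) = e * (of_int m * t) + 2 * pi * of_int (m * j)"
    by (simp add: algebra_simps)
  then show "cos (of_int m * (e * t + 2 * pi * of_int j)) = cos (of_int m * t)"
    and "sin (of_int m * (e * t + 2 * pi * of_int j)) = e * sin (of_int m * t)"
    using assms by (auto simp: cos_add sin_add simp del: of_int_mult)
qed

text \<open>This is the chain rule. It covers both the periods (\<open>a = b = 1\<close>) and the parities: with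
  \<open>a = -1\<close>, the derivative of an even function (\<open>b = 1\<close>) is odd and that of an odd function
  (\<open>b = -1\<close>) is even.\<close>

lemma deriv_affine_symmetry:
  fixes f :: "real \<Rightarrow> real"
  assumes sym: "\<And>x. f x = b * f (a * x + p)"
    and diff: "f field_differentiable at (a * t + p)"
  shows "deriv f t = b * a * deriv f (a * t + p)"
proof -
  have "(f has_field_derivative deriv f (a * t + p)) (at (a * t + p))"
    using diff by (simp add: DERIV_deriv_iff_field_differentiable)
  then have "((\<lambda>x. f (a * x + p)) has_field_derivative deriv f (a * t + p) * a) (at t)"
    by (rule DERIV_chain2) (auto intro!: derivative_eq_intros)
  then have "((\<lambda>x. b * f (a * x + p)) has_field_derivative b * (deriv f (a * t + p) * a)) (at t)"
    by (rule DERIV_cmult)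
  then have "(f has_field_derivative b * (deriv f (a * t + p) * a)) (at t)"
    by (simp only: sym[symmetric])
  then show ?thesis
    by (simp add: DERIV_imp_deriv)
qed

text \<open>Since \<open>s\<close> is congruent to \<open>e * t\<close> modulo \<open>2 * pi\<close>, this is the symmetry of the curve and of
  its velocity: \<open>\<phi>\<close> is even and \<open>\<psi>\<close> is odd, and for their derivatives it is the other way round.\<close>

lemma cosine_sine_sums_at_congruent_parameter:
  fixes c d :: "nat \<Rightarrow> real" and m :: "nat \<Rightarrow> int" and \<phi> \<psi> :: "real \<Rightarrow> real" and s t e :: real
  assumes phi: "\<phi> = (\<lambda>t. \<Sum>k=1..n. c k * cos (of_int (m k) * t))"
    and psi: "\<psi> = (\<lambda>t. \<Sum>k=1..n. d k * sin (of_int (m k) * t))"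
    and e: "e = 1 \<or> e = -1" and "cos s = cos t" "sin s = e * sin t"
  shows "\<phi> s = \<phi> t" "\<psi> s = e * \<psi> t" "deriv \<phi> s = e * deriv \<phi> t" "deriv \<psi> s = deriv \<psi> t"
proof -
  obtain j :: int where s: "s = e * t + 2 * pi * of_int j"
    using congruent_up_to_sign assms(3-5) by blast
  have ee: "e * e = 1"
    using e by auto
  have phi_sym: "\<phi> (e * x + 2 * pi * of_int j) = \<phi> x" for x
    unfolding phi by (simp only: sin_cos_integer_multiple_congruent[OF e])
  have psi_sym: "\<psi> (e * x + 2 * pi * of_int j) = e * \<psi> x" for x
    unfolding psi
    by (simp only: sin_cos_integer_multiple_congruent[OF e] sum_distrib_left mult.left_commute)
  show "\<phi> s = \<phi> t" "\<psi> s = e * \<psi> t"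
    using phi_sym psi_sym s by auto
  have diff: "\<phi> field_differentiable at x" "\<psi> field_differentiable at x" for x
    unfolding phi psi field_differentiable_def by (force intro!: derivative_eq_intros)+
  have "deriv \<phi> t = 1 * e * deriv \<phi> s"
    unfolding s by (rule deriv_affine_symmetry) (simp_all add: phi_sym diff)
  then show "deriv \<phi> s = e * deriv \<phi> t"
    using e by auto
  have "deriv \<psi> t = e * e * deriv \<psi> s"
    unfolding s
    by (rule deriv_affine_symmetry) (simp_all add: psi_sym diff ee flip: mult.assoc)
  then show "deriv \<psi> s = deriv \<psi> t"
    by (simp add: ee)
qed

theorem theorem3p9:
  fixes n :: nat and c d :: "nat \<Rightarrow> real" and m :: "nat \<Rightarrow> int"
    and \<phi> \<psi> :: "real \<Rightarrow> real" and S1 V1 :: "real poly"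
    and u0 t1 t2 x0 :: real
  assumes coprime: "Gcd (m ` {1..n}) = 1"
    and phi: "\<phi> = (\<lambda>t. \<Sum>k=1..n. c k * cos (of_int (m k) * t))"
    and psi: "\<psi> = (\<lambda>t. \<Sum>k=1..n. d k * sin (of_int (m k) * t))"
    and psi_factor: "\<And>t. \<psi> t = sin t * (poly S1 ((sin t)\<^sup>2) + cos t * poly V1 ((sin t)\<^sup>2))"
    and u0_root: "poly S1 (1 - u0\<^sup>2) + u0 * poly V1 (1 - u0\<^sup>2) = 0"
    and u0_range: "0 < u0" "u0 < 1"
    and cos_t: "u0 = cos t1" "u0 = cos t2"
    and sin_t: "sin t1 = sqrt (1 - u0\<^sup>2)" "- sin t2 = sqrt (1 - u0\<^sup>2)" "sqrt (1 - u0\<^sup>2) > 0"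
    and x0: "x0 = \<phi> t1"
  shows
    \<comment> \<open>the branches at the parameter values t1 and t2\<close>
    "(self_intersection_on {t1, t2} \<phi> \<psi> (x0, 0) \<longleftrightarrow> deriv \<phi> t1 \<noteq> 0 \<and> deriv \<psi> t1 \<noteq> 0)
     \<and> \<comment> \<open>the whole curve; only the converse needs that no further branch passes through (x0, 0)\<close>
     (deriv \<phi> t1 \<noteq> 0 \<and> deriv \<psi> t1 \<noteq> 0 \<longrightarrow> self_intersection \<phi> \<psi> (x0, 0))
     \<and>
     ((\<forall>t. (\<phi> t, \<psi> t) = (x0, 0) \<longrightarrow> cos t = u0) \<longrightarrow>
       (self_intersection \<phi> \<psi> (x0, 0) \<longleftrightarrow> deriv \<phi> t1 \<noteq> 0 \<and> deriv \<psi> t1 \<noteq> 0))"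
proof -
  have psi_t1: "\<psi> t1 = 0"
    using psi_factor[of t1] u0_root cos_t(1) by (simp add: sin_squared_eq)
  note at_congruent = cosine_sine_sums_at_congruent_parameter[OF phi psi]
  have opposite: "cos t2 = cos t1" "sin t2 = -1 * sin t1"
    using cos_t sin_t by auto
  have at_t2: "\<phi> t2 = \<phi> t1" "\<psi> t2 = - \<psi> t1"
    "deriv \<phi> t2 = - deriv \<phi> t1" "deriv \<psi> t2 = deriv \<psi> t1"
    using at_congruent[OF _ opposite] by auto
  have on_branches: "self_intersection_on {t1, t2} \<phi> \<psi> (x0, 0)"
    if nz: "deriv \<phi> t1 \<noteq> 0" "deriv \<psi> t1 \<noteq> 0"
  proof -
    have "has_slope \<phi> \<psi> t1 (ereal (deriv \<psi> t1 / deriv \<phi> t1))"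
      "has_slope \<phi> \<psi> t2 (ereal (- (deriv \<psi> t1 / deriv \<phi> t1)))"
      using nz by (simp_all add: has_slope_def at_t2)
    moreover have "ereal (deriv \<psi> t1 / deriv \<phi> t1) \<noteq> ereal (- (deriv \<psi> t1 / deriv \<phi> t1))"
      using nz by (simp add: field_simps)
    moreover have "(\<phi> t1, \<psi> t1) = (x0, 0)" "(\<phi> t2, \<psi> t2) = (x0, 0)"
      using x0 psi_t1 at_t2 by simp_all
    ultimately show ?thesis
      unfolding self_intersection_on_def by blast
  qed
  \<comment> \<open>In the degenerate case the slope does not depend on the branch, as \<open>- \<infinity>\<close> is not used and
    \<open>- 0 = 0\<close>, so two branches cannot have different slopes.\<close>
  have slope_if_degenerate: "\<sigma> = (if deriv \<phi> t1 = 0 then \<infinity> else 0)"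
    if deg: "\<not> (deriv \<phi> t1 \<noteq> 0 \<and> deriv \<psi> t1 \<noteq> 0)"
      and s: "cos s = u0" and slope: "has_slope \<phi> \<psi> s \<sigma>" for s \<sigma>
  proof -
    obtain e :: real where e: "e = 1 \<or> e = -1" "sin s = e * sin t1"
      using cos_eq_imp_sin_eq_sign s cos_t(1) by metis
    have "deriv \<phi> s = e * deriv \<phi> t1" "deriv \<psi> s = deriv \<psi> t1"
      using at_congruent[of e s t1] e s cos_t(1) by auto
    then show ?thesis
      using deg slope e(1) by (auto simp: has_slope_def zero_ereal_def)
  qed
  have nondegenerate: "deriv \<phi> t1 \<noteq> 0 \<and> deriv \<psi> t1 \<noteq> 0"
    if "self_intersection_on T \<phi> \<psi> (x0, 0)"
      and "\<And>t. t \<in> T \<Longrightarrow> (\<phi> t, \<psi> t) = (x0, 0) \<Longrightarrow> cos t = u0" for T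
    using that slope_if_degenerate unfolding self_intersection_on_def by metis
  have on_curve: "self_intersection \<phi> \<psi> (x0, 0)"
    if "deriv \<phi> t1 \<noteq> 0" "deriv \<psi> t1 \<noteq> 0"
    using on_branches[OF that] unfolding self_intersection_on_def by blast
  have "self_intersection_on {t1, t2} \<phi> \<psi> (x0, 0) \<longleftrightarrow> deriv \<phi> t1 \<noteq> 0 \<and> deriv \<psi> t1 \<noteq> 0"
    using on_branches nondegenerate[of "{t1, t2}"] cos_t by auto
  then show ?thesis
    using on_curve nondegenerate[of UNIV] by auto
qed

end
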